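(* Suppose Assumptions 1--4 listed in the context hold, with constants $G,M,R,\epsilon$, and that $\epsilon>\bar V(\mathbf g)$. Let $\{\mathbf x_t\},\{\boldsymbol\lambda_t\}$ be generated by the MOSP recursion (see context) with stepsizes $\alpha,\mu>0$ and $\boldsymbol\lambda_1=\mathbf 0$. Then for every $T\ge1$ the dynamic regret $\mathrm{Reg}^{\rm d}_T:=\sum_{t=1}^T f_t(\mathbf x_t)-\sum_{t=1}^T f_t(\mathbf x_t^* )$ satisfies $$\mathrm{Reg}^{\rm d}_T\le\frac{R\,V(\{\mathbf x_t^*\}_{t=1}^T)}{\alpha}+\Lambda\,V(\{\mathbf g_t\}_{t=1}^T)+\frac{R^2}{2\alpha}+\frac{\alpha G^2T}{2}+\frac{\mu M^2(T+1)}{2},$$ where $$V(\{\mathbf x_t^*\}_{t=1}^T):=\sum_{t=1}^T\|\mathbf x_t^*-\mathbf x_{t-1}^*\|,\qquad V(\{\mathbf g_t\}_{t=1}^T):=\sum_{t=1}^T V(\mathbf g_t)=\sum_{t=1}^T\max_{\mathbf x\in\mathcal X}\big\|[\mathbf g_{t+1}(\mathbf x)-\mathbf g_t(\mathbf x)]^+\big\|,$$ and $$\Lambda:=\mu M+\frac{2GR+R^2/(2\alpha)+\mu M^2/2}{\epsilon-\bar V(\mathbf g)}.$$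
   Context: Notation: $\|\cdot\|$ is the Euclidean norm, $[\mathbf a]^+:=\max\{\mathbf a,\mathbf 0\}$ entrywise, vector inequalities are entrywise, $\mathbf 1$ is the all-ones vector. Setting: $\mathcal X\subseteq\mathbb R^I$ is a fixed convex set. For each time slot $t$ there are a loss $f_t:\mathbb R^I\to\mathbb R$ and a constraint function $\mathbf g_t:\mathbb R^I\to\mathbb R^I$; slots are indexed by $t=0,1,2,\dots$, where slot $0$ only serves for initialization. All minima and maxima over $\mathcal X$ that are written down are assumed to be attained; a maximum over infinitely many $t$ is read as a supremum. Assumptions: 1. For every $t$, $f_t$ is convex (with gradient $\nabla f_t$) and $\mathbf g_t$ is (entrywise) convex. 2. For every $t$, $\|\nabla f_t(\mathbf x)\|\le G$ and $\|\mathbf g_t(\mathbf x)\|\le M$ for all $\mathbf x\in\mathcal X$. 3. $\|\mathbf x-\mathbf y\|\le R$ for all $\mathbf x,\mathbf y\in\mathcal X$. 4. There are a constant $\epsilon>0$ and an interior point $\tilde{\mathbf x}\in\mathcal X$ with $\mathbf g_t(\tilde{\mathbf x})\le-\epsilon\mathbf 1$ for all $t$. Per-slot minimizers: $\mathbf x_t^*\in\arg\min\{f_t(\mathbf x):\mathbf x\in\mathcal X,\ \mathbf g_t(\mathbf x)\le\mathbf 0\}$. Constraint variation: $V(\mathbf g_t):=\max_{\mathbf x\in\mathcal X}\|[\mathbf g_{t+1}(\mathbf x)-\mathbf g_t(\mathbf x)]^+\|$ and $\bar V(\mathbf g):=\max_{t\ge1}V(\mathbf g_t)$. MOSP recursion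 (modified online saddle-point method) with stepsizes $\alpha,\mu>0$: start from $\mathbf x_0\in\mathcal X$ and a dual vector $\boldsymbol\lambda_1\in\mathbb R^I_+$; for $t=1,2,\dots$ let $\mathbf x_t$ be the minimizer over $\mathbf x\in\mathcal X$ of $$\nabla f_{t-1}(\mathbf x_{t-1})^\top(\mathbf x-\mathbf x_{t-1})+\boldsymbol\lambda_t^\top\mathbf g_{t-1}(\mathbf x)+\frac{1}{2\alpha}\|\mathbf x-\mathbf x_{t-1}\|^2,$$ and set $\boldsymbol\lambda_{t+1}=[\boldsymbol\lambda_t+\mu\,\mathbf g_t(\mathbf x_t)]^+$. *)

theory Defs
  imports "HOL-Analysis.Analysis"
begin

definition pos_part :: "real^'n \<Rightarrow> real^'n" where
  "pos_part a = (\<chi> i. max (a $ i) 0)"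

definition constr_increase :: "(nat \<Rightarrow> real^'n \<Rightarrow> real^'n) \<Rightarrow> nat \<Rightarrow> real^'n \<Rightarrow> real" where
  "constr_increase g t x = norm (pos_part (g (Suc t) x - g t x))"

text \<open>The maximum over \<open>X\<close> is written as a supremum; the two agree exactly when the maximum
  is attained, which has to be assumed wherever \<open>constr_var\<close> is meant as a maximum.\<close>

definition constr_var :: "(real^'n) set \<Rightarrow> (nat \<Rightarrow> real^'n \<Rightarrow> real^'n) \<Rightarrow> nat \<Rightarrow> real" where
  "constr_var X g t = (SUP x\<in>X. constr_increase g t x)"

text \<open>If all \<open>g t\<close> are bounded on the nonempty set \<open>X\<close> by a common constant, then all suprema
  here range over nonempty sets of reals that are bounded above.\<close>

definition constr_var_sup :: "(real^'n) set \<Rightarrow> (nat \<Rightarrow> real^'n \<Rightarrow> real^'n) \<Rightarrow> real" where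
  "constr_var_sup X g = (SUP t\<in>{1..}. constr_var X g t)"

definition total_constr_var :: "(real^'n) set \<Rightarrow> (nat \<Rightarrow> real^'n \<Rightarrow> real^'n) \<Rightarrow> nat \<Rightarrow> real" where
  "total_constr_var X g T = (\<Sum>t=1..T. constr_var X g t)"

definition path_var :: "(nat \<Rightarrow> real^'n) \<Rightarrow> nat \<Rightarrow> real" where
  "path_var z T = (\<Sum>t=1..T. norm (z t - z (t - 1)))"

definition slot_minimizer ::
  "(real^'n) set \<Rightarrow> (nat \<Rightarrow> real^'n \<Rightarrow> real) \<Rightarrow> (nat \<Rightarrow> real^'n \<Rightarrow> real^'n) \<Rightarrow> nat \<Rightarrow> real^'n \<Rightarrow> bool"
  where "slot_minimizer X f g t z \<longleftrightarrow> is_arg_min (f t) (\<lambda>x. x \<in> X \<and> g t x \<le> 0) z"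

definition dyn_regret ::
  "(nat \<Rightarrow> real^'n \<Rightarrow> real) \<Rightarrow> (nat \<Rightarrow> real^'n) \<Rightarrow> (nat \<Rightarrow> real^'n) \<Rightarrow> nat \<Rightarrow> real"
  where "dyn_regret f x z T = (\<Sum>t=1..T. f t (x t)) - (\<Sum>t=1..T. f t (z t))"

text \<open>\<open>df t\<close> is the gradient field of the loss of slot \<open>t\<close>; the value \<open>l 0\<close> is irrelevant.\<close>

definition mosp ::
  "(real^'n) set \<Rightarrow> (nat \<Rightarrow> real^'n \<Rightarrow> real^'n) \<Rightarrow> (nat \<Rightarrow> real^'n \<Rightarrow> real^'n) \<Rightarrow> real \<Rightarrow> real
    \<Rightarrow> (nat \<Rightarrow> real^'n) \<Rightarrow> (nat \<Rightarrow> real^'n) \<Rightarrow> bool"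
  where "mosp X df g \<alpha> \<mu> x l \<longleftrightarrow>
    x 0 \<in> X \<and> 0 \<le> l 1 \<and>
    (\<forall>t\<ge>1.
       is_arg_min
         (\<lambda>y. df (t - 1) (x (t - 1)) \<bullet> (y - x (t - 1)) + l t \<bullet> g (t - 1) y
              + 1 / (2 * \<alpha>) * (norm (y - x (t - 1)))\<^sup>2)
         (\<lambda>y. y \<in> X) (x t)
     \<and> l (t + 1) = pos_part (l t + \<mu> *\<^sub>R g t (x t)))"

text \<open>The bound on the norms of the dual iterates; \<open>v\<close> stands for \<open>constr_var_sup X g\<close>.\<close>

definition dual_bound :: "real \<Rightarrow> real \<Rightarrow> real \<Rightarrow> real \<Rightarrow> real \<Rightarrow> real \<Rightarrow> real \<Rightarrow> real" where
  "dual_bound G M R \<epsilon> \<alpha> \<mu> v =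
     \<mu> * M + (2 * G * R + R\<^sup>2 / (2 * \<alpha>) + \<mu> * M\<^sup>2 / 2) / (\<epsilon> - v)"

end

theory Submission
  imports Defs
begin

text \<open>Strong convexity of the primal objective compares \<open>x\<^bsub>t+1\<^esub>\<close> with \<open>x\<^sub>t\<^sup>*\<close> and bounds the
  instantaneous regret plus \<open>\<lambda>\<^bsub>t+1\<^esub> \<bullet> g\<^sub>t(x\<^bsub>t+1\<^esub>)\<close> by a difference of squared distances. Replacing
  \<open>g\<^sub>t\<close> by \<open>g\<^bsub>t+1\<^esub>\<close> costs \<open>\<parallel>\<lambda>\<^bsub>t+1\<^esub>\<parallel> V(g\<^sub>t)\<close> and turns the inner product into a drift of \<open>\<parallel>\<lambda>\<parallel>\<^sup>2\<close>, so
  everything telescopes. The dual iterates stay bounded because the Slater point makes the drift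
  negative as soon as \<open>\<parallel>\<lambda>\<parallel>\<close> exceeds the fraction in \<open>\<Lambda>\<close>, while one step adds at most \<open>\<mu> M\<close>.\<close>

section \<open>Convexity: proximal minimizers and tangents\<close>

text \<open>The minimizer is compared with the points \<open>(1 - s) z + s y\<close> of the segment
  towards \<open>y\<close>. Convexity of \<open>\<phi>\<close> is used along it, while the squared
  distance to \<open>p\<close> obeys an exact identity whose deficit is \<open>s (1 - s)\<close>
  times the squared length of the segment. Cancelling \<open>s\<close> and letting it tend to 0
  leaves the full term \<open>c * (norm (y - z))\<^sup>2\<close>.\<close>

lemma prox_three_point:
  fixes \<phi> :: "'a::real_inner \<Rightarrow> real"
  assumes conv: "convex_on X \<phi>"
    and min: "is_arg_min (\<lambda>y. \<phi> y + c * (norm (y - p))\<^sup>2) (\<lambda>y. y \<in> X) z"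
    and y: "y \<in> X"
  shows "\<phi> z + c * (norm (z - p))\<^sup>2 \<le> \<phi> y + c * (norm (y - p))\<^sup>2 - c * (norm (y - z))\<^sup>2"
proof -
  have z: "z \<in> X" and le: "\<And>w. w \<in> X \<Longrightarrow> \<phi> z + c * (norm (z - p))\<^sup>2 \<le> \<phi> w + c * (norm (w - p))\<^sup>2"
    using min by (auto simp: is_arg_min_linorder)
  define A where "A = \<phi> z + c * (norm (z - p))\<^sup>2"
  define B where "B = \<phi> y + c * (norm (y - p))\<^sup>2"
  define D where "D = c * (norm (y - z))\<^sup>2"
  \<comment> \<open>The factor \<open>1 - s\<close> is what remains of \<open>s * (1 - s)\<close>
    once \<open>s\<close> is cancelled; it disappears in the limit from the right at 0.\<close>
  have *: "A \<le> B - (1 - s) * D" if s: "0 < s" "s < 1" for s :: real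
  proof -
    define w where "w = (1 - s) *\<^sub>R z + s *\<^sub>R y"
    have "w \<in> X"
      using convexD_alt[OF convex_on_imp_convex[OF conv] z y, of s] s by (simp add: w_def)
    moreover have "\<phi> w \<le> (1 - s) * \<phi> z + s * \<phi> y"
      using convex_onD[OF conv, of s z y] s z y by (simp add: w_def)
    moreover have "(norm (w - p))\<^sup>2 =
        (1 - s) * (norm (z - p))\<^sup>2 + s * (norm (y - p))\<^sup>2 - s * (1 - s) * (norm (y - z))\<^sup>2"
      unfolding w_def power2_norm_eq_inner
      by (simp add: algebra_simps inner_commute)
    ultimately have "A \<le> (1 - s) * \<phi> z + s * \<phi> y + c * ((1 - s) * (norm (z - p))\<^sup>2
        + s * (norm (y - p))\<^sup>2 - s * (1 - s) * (norm (y - z))\<^sup>2)"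
      using le[of w] by (simp add: A_def)
    also have "\<dots> = (1 - s) * A + s * (B - (1 - s) * D)"
      by (simp add: A_def B_def D_def algebra_simps)
    finally have "s * A \<le> s * (B - (1 - s) * D)"
      by (simp add: algebra_simps)
    then show ?thesis using s by simp
  qed
  have "((\<lambda>s. B - (1 - s) * D) \<longlongrightarrow> B - (1 - 0) * D) (at_right (0::real))"
    by (intro tendsto_intros)
  moreover have "\<forall>\<^sub>F s in at_right (0::real). A \<le> B - (1 - s) * D"
    using eventually_at_right_real[of 0 1] by (rule eventually_mono) (auto intro: *)
  ultimately have "A \<le> B - (1 - 0) * D"
    by (rule tendsto_lowerbound) simp
  then show ?thesis by (simp add: A_def B_def D_def)
qed

text \<open>Restriction to the line through \<open>x\<close> and \<open>y\<close> reduces this to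
  the tangent inequality for a convex function of one real variable, between the parameters 0 and
  1.\<close>

lemma convex_GDERIV_above_tangent:
  fixes f :: "'a::real_inner \<Rightarrow> real"
  assumes conv: "convex_on UNIV f" and deriv: "GDERIV f x :> d"
  shows "f x + d \<bullet> (y - x) \<le> f y"
proof -
  define h where "h s = f (x + s *\<^sub>R (y - x))" for s
  have "convex_on UNIV h"
  proof (rule convex_onI)
    fix t a b :: real
    assume "0 < t" "t < 1"
    then show "h ((1 - t) *\<^sub>R a + t *\<^sub>R b) \<le> (1 - t) * h a + t * h b"
      using convex_onD[OF conv, of t "x + a *\<^sub>R (y - x)" "x + b *\<^sub>R (y - x)"]
      by (simp add: h_def algebra_simps)
  qed simp
  moreover have "(h has_real_derivative d \<bullet> (y - x)) (at 0)"
  proof -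
    \<comment> \<open>The base point is written with \<open>0 *\<^sub>R (y - x)\<close> so that it
      is literally the value of the line at parameter 0, as the chain rule expects.\<close>
    have f: "(f has_derivative (\<lambda>v. v \<bullet> d)) (at (x + 0 *\<^sub>R (y - x)))"
      using deriv by (simp add: gderiv_def)
    have "((\<lambda>s::real. x + s *\<^sub>R (y - x)) has_derivative (\<lambda>s. s *\<^sub>R (y - x))) (at 0)"
      by (auto intro!: derivative_eq_intros)
    from has_derivative_compose[OF this f] show ?thesis
      by (simp add: h_def[abs_def] has_field_derivative_def inner_commute mult_commute_abs)
  qed
  ultimately have "h 1 - h 0 \<ge> d \<bullet> (y - x) * (1 - 0)"
    by (intro convex_on_imp_above_tangent[of UNIV]) auto
  then show ?thesis by (simp add: h_def)
qed

section \<open>Entrywise order and positive part\<close>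

lemma inner_left_mono_vec:
  fixes l a b :: "real^'n"
  assumes "0 \<le> l" "a \<le> b"
  shows "l \<bullet> a \<le> l \<bullet> b"
  using assms by (auto simp: inner_vec_def less_eq_vec_def intro!: sum_mono mult_left_mono)

text \<open>For a nonnegative vector the inner product with \<open>1\<close> is the l1 norm. This
  converts the entrywise Slater bound, paired with a dual vector, into \<open>- \<epsilon>\<close>
  times the Euclidean norm of that vector.\<close>

lemma norm_le_inner_one:
  fixes l :: "real^'n"
  assumes "0 \<le> l"
  shows "norm l \<le> l \<bullet> 1"
  using norm_le_l1_cart[of l] assms by (simp add: inner_vec_def less_eq_vec_def)

lemma convex_on_inner_vec:
  fixes l :: "real^'n"
  assumes "convex S" "0 \<le> l" and g: "\<And>i. convex_on S (\<lambda>y. g y $ i)"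
  shows "convex_on S (\<lambda>y. l \<bullet> g y)"
proof (rule convex_onI)
  fix t :: real and x y
  assume "0 < t" "t < 1" "x \<in> S" "y \<in> S"
  then have "g ((1 - t) *\<^sub>R x + t *\<^sub>R y) \<le> (1 - t) *\<^sub>R g x + t *\<^sub>R g y"
    using convex_onD[OF g, of t x y] by (simp add: less_eq_vec_def)
  from inner_left_mono_vec[OF \<open>0 \<le> l\<close> this]
  show "l \<bullet> g ((1 - t) *\<^sub>R x + t *\<^sub>R y) \<le> (1 - t) * (l \<bullet> g x) + t * (l \<bullet> g y)"
    by (simp add: inner_add_right)
qed fact

lemma pos_part_nonneg: "0 \<le> pos_part a"
  by (simp add: pos_part_def less_eq_vec_def)

lemma pos_part_ge: "a \<le> pos_part a"
  by (simp add: pos_part_def less_eq_vec_def)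

lemma norm_pos_part_le: "norm (pos_part a) \<le> norm a"
  by (rule norm_le_componentwise_cart) (auto simp: pos_part_def)

text \<open>The positive part does not increase the norm, so it suffices to estimate
  \<open>l + \<mu> a\<close>: by the triangle inequality for the growth per dual step, by expanding
  the square for the drift.\<close>

lemma norm_pos_part_step:
  fixes l a :: "real^'n"
  assumes "norm a \<le> M" "0 < \<mu>"
  shows "norm (pos_part (l + \<mu> *\<^sub>R a)) \<le> norm l + \<mu> * M"
    and "((norm (pos_part (l + \<mu> *\<^sub>R a)))\<^sup>2 - (norm l)\<^sup>2) / (2 * \<mu>) \<le> l \<bullet> a + \<mu> * M\<^sup>2 / 2"
proof -
  have "norm (pos_part (l + \<mu> *\<^sub>R a)) \<le> norm (l + \<mu> *\<^sub>R a)"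
    by (rule norm_pos_part_le)
  also have "\<dots> \<le> norm l + norm (\<mu> *\<^sub>R a)"
    by (rule norm_triangle_ineq)
  finally show "norm (pos_part (l + \<mu> *\<^sub>R a)) \<le> norm l + \<mu> * M"
    using mult_left_mono[OF assms(1), of \<mu>] assms(2) unfolding norm_scaleR by linarith
  have "(norm (pos_part (l + \<mu> *\<^sub>R a)))\<^sup>2 \<le> (norm (l + \<mu> *\<^sub>R a))\<^sup>2"
    by (intro power_mono norm_pos_part_le) simp
  also have "\<dots> = (norm l)\<^sup>2 + 2 * \<mu> * (l \<bullet> a) + \<mu>\<^sup>2 * (norm a)\<^sup>2"
    unfolding power2_norm_eq_inner by (simp add: algebra_simps inner_commute power2_eq_square)
  also have "\<dots> \<le> (norm l)\<^sup>2 + 2 * \<mu> * (l \<bullet> a) + \<mu>\<^sup>2 * M\<^sup>2"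
    using assms by (intro add_left_mono mult_left_mono power_mono) auto
  finally show "((norm (pos_part (l + \<mu> *\<^sub>R a)))\<^sup>2 - (norm l)\<^sup>2) / (2 * \<mu>) \<le> l \<bullet> a + \<mu> * M\<^sup>2 / 2"
    using assms(2) by (simp add: field_simps power2_eq_square)
qed

section \<open>Constraint variation\<close>

text \<open>This uniform bound makes the suprema in \<open>constr_var\<close> and
  \<open>constr_var_sup\<close> range over sets that are bounded above, so that they really dominate
  their members.\<close>

lemma constr_increase_le:
  assumes "norm (g (Suc t) y) \<le> M" "norm (g t y) \<le> M"
  shows "constr_increase g t y \<le> 2 * M"
  using norm_pos_part_le[of "g (Suc t) y - g t y"] norm_triangle_ineq4[of "g (Suc t) y" "g t y"] assms
  unfolding constr_increase_def by linarith

lemma constr_increase_le_var: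
  assumes bdd: "\<And>t y. y \<in> X \<Longrightarrow> norm (g t y) \<le> M" and "y \<in> X"
  shows "constr_increase g t y \<le> constr_var X g t"
  unfolding constr_var_def using constr_increase_le[of g t _ M] bdd \<open>y \<in> X\<close>
  by (intro cSUP_upper bdd_aboveI2[of X _ "2 * M"]) auto

text \<open>Against a nonnegative multiplier only increases of the constraint can hurt, which is why
  the positive part suffices; Cauchy-Schwarz then gives the price of replacing slot \<open>t\<close>
  by its successor.\<close>

lemma inner_constr_step:
  assumes bdd: "\<And>t y. y \<in> X \<Longrightarrow> norm (g t y) \<le> M" and "y \<in> X" and l: "0 \<le> l"
  shows "l \<bullet> g (Suc t) y \<le> l \<bullet> g t y + norm l * constr_var X g t"
proof -
  have "l \<bullet> (g (Suc t) y - g t y) \<le> l \<bullet> pos_part (g (Suc t) y - g t y)"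
    by (intro inner_left_mono_vec l pos_part_ge)
  also have "\<dots> \<le> norm l * constr_increase g t y"
    unfolding constr_increase_def by (rule norm_cauchy_schwarz)
  also have "\<dots> \<le> norm l * constr_var X g t"
    using constr_increase_le_var[OF bdd \<open>y \<in> X\<close>] by (intro mult_left_mono) auto
  finally show ?thesis by (simp add: inner_diff_right)
qed

lemma constr_var_le_sup:
  assumes bdd: "\<And>t y. y \<in> X \<Longrightarrow> norm (g t y) \<le> M" and "X \<noteq> {}" and "t \<ge> 1"
  shows "constr_var X g t \<le> constr_var_sup X g"
proof -
  have "constr_var X g s \<le> 2 * M" for s
    unfolding constr_var_def using \<open>X \<noteq> {}\<close> bdd by (intro cSUP_least constr_increase_le) auto
  then show ?thesis
    unfolding constr_var_sup_def using \<open>t \<ge> 1\<close>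
    by (intro cSUP_upper bdd_aboveI2[of _ _ "2 * M"]) auto
qed

section \<open>Telescoping along a moving comparator\<close>

text \<open>The sum would telescope for a constant \<open>z\<close>. Moving the comparator changes a
  squared distance \<open>b\<^sup>2\<close> to \<open>a\<^sup>2\<close>, and
  \<open>(a - b) * (a + b)\<close> is at most the length of the move times
  \<open>2 * R\<close>.\<close>

lemma sum_dist_telescope_le:
  fixes x z :: "nat \<Rightarrow> real^'n"
  assumes "\<And>s t. norm (z s - x t) \<le> R"
  shows "(\<Sum>t=1..T. (norm (z t - x t))\<^sup>2 - (norm (z t - x (Suc t)))\<^sup>2) \<le> 2 * R * path_var z T + R\<^sup>2"
proof -
  \<comment> \<open>The last distance is kept on the right to strengthen the induction: it is the
    \<open>b\<^sup>2\<close> against which the next \<open>a\<^sup>2\<close> is compared.\<close>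
  have *: "(\<Sum>t=1..T. (norm (z t - x t))\<^sup>2 - (norm (z t - x (Suc t)))\<^sup>2)
      \<le> 2 * R * path_var z T + R\<^sup>2 - (norm (z T - x (Suc T)))\<^sup>2"
  proof (induction T)
    case 0
    show ?case using power_mono[OF assms[of 0 1], of 2] by (simp add: path_var_def)
  next
    case (Suc T)
    define a b where "a = norm (z (Suc T) - x (Suc T))" and "b = norm (z T - x (Suc T))"
    have "\<bar>a - b\<bar> \<le> norm (z (Suc T) - z T)"
      unfolding a_def b_def using norm_triangle_ineq3[of "z (Suc T) - x (Suc T)" "z T - x (Suc T)"]
      by simp
    moreover have "a + b \<le> 2 * R" "0 \<le> a + b"
      using assms[of "Suc T" "Suc T"] assms[of T "Suc T"] by (auto simp: a_def b_def)
    ultimately have "(a - b) * (a + b) \<le> norm (z (Suc T) - z T) * (2 * R)"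
      by (intro mult_mono) auto
    then have "a\<^sup>2 \<le> b\<^sup>2 + 2 * R * norm (z (Suc T) - z T)"
      by (simp add: algebra_simps power2_eq_square)
    then show ?case
      using Suc.IH by (simp add: path_var_def a_def b_def algebra_simps)
  qed
  also have "\<dots> \<le> 2 * R * path_var z T + R\<^sup>2" by simp
  finally show ?thesis .
qed

section \<open>The iterates of the recursion\<close>

lemma mosp_dual_nonneg:
  assumes "mosp X df g \<alpha> \<mu> x l" "t \<ge> 1"
  shows "0 \<le> l t"
proof (cases "t = 1")
  case False
  then have "t - 1 \<ge> 1" "t - 1 + 1 = t" using assms(2) by auto
  then have "l t = pos_part (l (t - 1) + \<mu> *\<^sub>R g (t - 1) (x (t - 1)))"
    using assms(1) unfolding mosp_def by metis
  then show ?thesis by (simp add: pos_part_nonneg)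
qed (use assms in \<open>simp add: mosp_def\<close>)

lemma mosp_primal_in:
  assumes "mosp X df g \<alpha> \<mu> x l"
  shows "x t \<in> X"
  using assms by (cases "t = 0") (auto simp: mosp_def is_arg_min_def)

lemma mosp_dual_step:
  assumes "mosp X df g \<alpha> \<mu> x l" "t \<ge> 1"
  shows "l (Suc t) = pos_part (l t + \<mu> *\<^sub>R g t (x t))"
  using assms by (simp add: mosp_def)

text \<open>The three-point inequality with \<open>c = 1 / (2 * \<alpha>)\<close> and centre
  \<open>x t\<close>. The linearised loss plus the constraint term is convex because the multiplier
  is nonnegative.\<close>

lemma mosp_primal_step:
  assumes mosp: "mosp X df g \<alpha> \<mu> x l" and X: "convex X"
    and g: "\<And>i. convex_on UNIV (\<lambda>y. g t y $ i)" and y: "y \<in> X"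
  shows "df t (x t) \<bullet> (x (Suc t) - x t) + l (Suc t) \<bullet> g t (x (Suc t))
      + (norm (x (Suc t) - x t))\<^sup>2 / (2 * \<alpha>)
    \<le> df t (x t) \<bullet> (y - x t) + l (Suc t) \<bullet> g t y
      + (norm (y - x t))\<^sup>2 / (2 * \<alpha>) - (norm (y - x (Suc t)))\<^sup>2 / (2 * \<alpha>)"
proof -
  have "convex_on X (\<lambda>y. df t (x t) \<bullet> (y - x t))"
    using X by (intro convex_onI) (auto simp: algebra_simps)
  moreover have "convex_on X (\<lambda>y. l (Suc t) \<bullet> g t y)"
    using mosp_dual_nonneg[OF mosp, of "Suc t"] convex_on_subset[OF g _ X]
    by (intro convex_on_inner_vec X) auto
  ultimately have conv: "convex_on X (\<lambda>y. df t (x t) \<bullet> (y - x t) + l (Suc t) \<bullet> g t y)"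
    by (rule convex_on_add)
  have "is_arg_min (\<lambda>y. df t (x t) \<bullet> (y - x t) + l (Suc t) \<bullet> g t y
      + 1 / (2 * \<alpha>) * (norm (y - x t))\<^sup>2) (\<lambda>y. y \<in> X) (x (Suc t))"
    using mosp[unfolded mosp_def, THEN conjunct2, THEN conjunct2, THEN spec, of "Suc t"] by simp
  from prox_three_point[OF conv this y] show ?thesis by simp
qed

text \<open>Testing the primal step with the Slater point gains \<open>\<epsilon>\<close> times the
  dual norm, of which the change of constraints takes back at most \<open>v\<close> times that norm.
  The drift is thus at most \<open>N - (\<epsilon> - v) * norm (l (Suc s))\<close>. Below the
  threshold \<open>N / (\<epsilon> - v)\<close> one step adds at most \<open>\<mu> * M\<close>;
  above it the norm drops and the induction hypothesis persists.\<close>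

lemma mosp_dual_bound:
  assumes mosp: "mosp X df g \<alpha> \<mu> x l" and X: "convex X"
    and g: "\<And>t i. convex_on UNIV (\<lambda>y. g t y $ i)"
    and G: "\<And>t y. y \<in> X \<Longrightarrow> norm (df t y) \<le> G"
    and M: "\<And>t y. y \<in> X \<Longrightarrow> norm (g t y) \<le> M"
    and R: "\<And>y z. y \<in> X \<Longrightarrow> z \<in> X \<Longrightarrow> norm (y - z) \<le> R"
    and y: "y \<in> X" and slater: "\<And>t. g t y \<le> - (\<epsilon> *\<^sub>R 1)"
    and eps: "0 < \<epsilon>" "constr_var_sup X g < \<epsilon>"
    and pos: "0 < \<alpha>" "0 < \<mu>" and l1: "l 1 = 0"
  shows "norm (l (Suc t)) \<le> dual_bound G M R \<epsilon> \<alpha> \<mu> (constr_var_sup X g)"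
proof -
  define v where "v = constr_var_sup X g"
  define N where "N = 2 * G * R + R\<^sup>2 / (2 * \<alpha>) + \<mu> * M\<^sup>2 / 2"
  have "0 \<le> G" "0 \<le> M" "0 \<le> R"
    using order_trans[OF norm_ge_zero G[OF y]] order_trans[OF norm_ge_zero M[OF y]]
      order_trans[OF norm_ge_zero R[OF y y]] by auto
  then have "0 \<le> N" using pos by (simp add: N_def)
  have bound: "dual_bound G M R \<epsilon> \<alpha> \<mu> v = \<mu> * M + N / (\<epsilon> - v)"
    by (simp add: dual_bound_def N_def)
  note xin = mosp_primal_in[OF mosp]
  have step: "norm (l (Suc s)) \<le> norm (l s) + \<mu> * M" if "s \<ge> 1" for s
    unfolding mosp_dual_step[OF mosp that] by (rule norm_pos_part_step(1)) (use M xin pos in auto)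
  \<comment> \<open>The supremum \<open>v\<close> covers the variations of slots from 1 on, hence
    \<open>s \<ge> 1\<close>.\<close>
  have drift: "((norm (l (Suc (Suc s))))\<^sup>2 - (norm (l (Suc s)))\<^sup>2) / (2 * \<mu>)
      \<le> N - (\<epsilon> - v) * norm (l (Suc s))" if "s \<ge> 1" for s
  proof -
    let ?l = "l (Suc s)" and ?x = "x (Suc s)"
    have lnn: "0 \<le> ?l" using mosp_dual_nonneg[OF mosp] by simp
    have "((norm (l (Suc (Suc s))))\<^sup>2 - (norm ?l)\<^sup>2) / (2 * \<mu>) \<le> ?l \<bullet> g (Suc s) ?x + \<mu> * M\<^sup>2 / 2"
      unfolding mosp_dual_step[OF mosp, of "Suc s", simplified]
      by (rule norm_pos_part_step(2)) (use M xin pos in auto)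
    also have "?l \<bullet> g (Suc s) ?x \<le> ?l \<bullet> g s ?x + norm ?l * constr_var X g s"
      using M xin lnn by (rule inner_constr_step)
    also have "norm ?l * constr_var X g s \<le> norm ?l * v"
      unfolding v_def using constr_var_le_sup[of X g M s] M y that by (intro mult_left_mono) auto
    also have "?l \<bullet> g s ?x \<le> 2 * G * R + R\<^sup>2 / (2 * \<alpha>) - \<epsilon> * norm ?l"
    proof -
      have "df s (x s) \<bullet> (y - ?x) \<le> norm (df s (x s)) * norm (y - ?x)"
        by (rule norm_cauchy_schwarz)
      also have "\<dots> \<le> G * R" using G R xin y \<open>0 \<le> G\<close> by (intro mult_mono) auto
      finally have "df s (x s) \<bullet> (y - x s) - df s (x s) \<bullet> (?x - x s) \<le> G * R"
        by (simp add: inner_diff_right)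
      moreover have "?l \<bullet> g s y \<le> - (\<epsilon> * norm ?l)"
        using inner_left_mono_vec[OF lnn slater[of s]] eps
          mult_left_mono[OF norm_le_inner_one[OF lnn], of \<epsilon>]
        unfolding inner_minus_right inner_scaleR_right by linarith
      moreover have "(norm (y - x s))\<^sup>2 / (2 * \<alpha>) \<le> R\<^sup>2 / (2 * \<alpha>)"
        using R xin y pos by (intro divide_right_mono power_mono) auto
      \<comment> \<open>Both gradient terms together cost \<open>G * R\<close>; adding the
        nonnegative \<open>G * R\<close> gives the \<open>2 * G * R\<close> of
        \<open>N\<close>.\<close>
      moreover have "0 \<le> (norm (?x - x s))\<^sup>2 / (2 * \<alpha>)" "0 \<le> (norm (y - ?x))\<^sup>2 / (2 * \<alpha>)" "0 \<le> G * R"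
        using pos \<open>0 \<le> G\<close> \<open>0 \<le> R\<close> by auto
      ultimately show ?thesis
        using mosp_primal_step[OF mosp X g y, of s] by linarith
    qed
    finally show ?thesis by (simp add: N_def algebra_simps)
  qed
  have "norm (l (Suc t)) \<le> \<mu> * M + N / (\<epsilon> - v)"
  proof (induction t)
    case 0
    show ?case using l1 pos \<open>0 \<le> M\<close> \<open>0 \<le> N\<close> eps by (simp add: v_def)
  next
    case (Suc s)
    \<comment> \<open>For \<open>s = 0\<close> the vector \<open>l 1 = 0\<close> falls under the
      first alternative, so the second may assume \<open>s \<ge> 1\<close> and use the drift
      bound.\<close>
    consider "norm (l (Suc s)) \<le> N / (\<epsilon> - v)" | "s \<ge> 1" "N / (\<epsilon> - v) < norm (l (Suc s))"
      using l1 \<open>0 \<le> N\<close> eps by (cases s) (force simp: v_def)+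
    then show ?case
    proof cases
      case 1
      then show ?thesis using step[of "Suc s"] by simp
    next
      case 2
      then have "N - (\<epsilon> - v) * norm (l (Suc s)) < 0"
        using eps by (simp add: v_def pos_divide_less_eq mult.commute)
      then have "(norm (l (Suc (Suc s))))\<^sup>2 < (norm (l (Suc s)))\<^sup>2"
        using order.strict_trans1[OF drift[OF 2(1)], of 0] pos by (simp add: divide_less_0_iff)
      then have "norm (l (Suc (Suc s))) < norm (l (Suc s))"
        by (rule power_less_imp_less_base) simp
      then show ?thesis using Suc.IH by simp
    qed
  qed
  then show ?thesis by (simp add: bound flip: v_def)
qed

section \<open>Regret: one slot, then the sum\<close>

text \<open>The primal step is tested with a feasible \<open>z\<close>, where the constraint term
  has the right sign. The gradient term along the step is absorbed by the proximal term, and the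
  remaining inner product is exchanged for the dual drift of the next slot.\<close>

lemma mosp_slot_regret:
  assumes mosp: "mosp X df g \<alpha> \<mu> x l" and X: "convex X"
    and f: "convex_on UNIV (f t)" and df: "\<And>y. GDERIV (f t) y :> df t y"
    and g: "\<And>i. convex_on UNIV (\<lambda>y. g t y $ i)"
    and G: "\<And>y. y \<in> X \<Longrightarrow> norm (df t y) \<le> G"
    and M: "\<And>t y. y \<in> X \<Longrightarrow> norm (g t y) \<le> M"
    and z: "z \<in> X" "g t z \<le> 0" and pos: "0 < \<alpha>" "0 < \<mu>"
  shows "f t (x t) - f t z
    \<le> ((norm (z - x t))\<^sup>2 - (norm (z - x (Suc t)))\<^sup>2) / (2 * \<alpha>) + \<alpha> * G\<^sup>2 / 2 + \<mu> * M\<^sup>2 / 2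
      + norm (l (Suc t)) * constr_var X g t
      - ((norm (l (Suc (Suc t))))\<^sup>2 - (norm (l (Suc t)))\<^sup>2) / (2 * \<mu>)"
proof -
  let ?l = "l (Suc t)" and ?x = "x (Suc t)" and ?d = "df t (x t)"
  note xin = mosp_primal_in[OF mosp]
  have lnn: "0 \<le> ?l" using mosp_dual_nonneg[OF mosp] by simp
  have "f t (x t) + ?d \<bullet> (z - x t) \<le> f t z"
    using f df by (rule convex_GDERIV_above_tangent)
  moreover have "?l \<bullet> g t z \<le> 0"
    using inner_left_mono_vec[OF lnn z(2)] by simp
  \<comment> \<open>Young's inequality, weighted so that its quadratic term is exactly the proximal
    term on the left of the primal step.\<close>
  moreover have "- (?d \<bullet> (?x - x t)) \<le> \<alpha> * G\<^sup>2 / 2 + (norm (?x - x t))\<^sup>2 / (2 * \<alpha>)"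
  proof -
    have "0 \<le> (norm (\<alpha> *\<^sub>R ?d + (?x - x t)))\<^sup>2" by simp
    also have "\<dots> = \<alpha>\<^sup>2 * (norm ?d)\<^sup>2 + 2 * \<alpha> * (?d \<bullet> (?x - x t)) + (norm (?x - x t))\<^sup>2"
      unfolding power2_norm_eq_inner by (simp add: algebra_simps inner_commute power2_eq_square)
    also have "\<alpha>\<^sup>2 * (norm ?d)\<^sup>2 \<le> \<alpha>\<^sup>2 * G\<^sup>2"
      using G xin by (intro mult_left_mono power_mono) auto
    finally show ?thesis using pos by (simp add: field_simps power2_eq_square)
  qed
  moreover have "((norm (l (Suc (Suc t))))\<^sup>2 - (norm ?l)\<^sup>2) / (2 * \<mu>)
      \<le> ?l \<bullet> g (Suc t) ?x + \<mu> * M\<^sup>2 / 2"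
    unfolding mosp_dual_step[OF mosp, of "Suc t", simplified]
    by (rule norm_pos_part_step(2)) (use M xin pos in auto)
  moreover have "?l \<bullet> g (Suc t) ?x \<le> ?l \<bullet> g t ?x + norm ?l * constr_var X g t"
    using M xin lnn by (rule inner_constr_step)
  moreover note mosp_primal_step[OF mosp X g z(1)]
  ultimately show ?thesis unfolding diff_divide_distrib by linarith
qed

theorem theorem2:
  fixes X :: "(real^'n) set"
    and f :: "nat \<Rightarrow> real^'n \<Rightarrow> real"
    and df :: "nat \<Rightarrow> real^'n \<Rightarrow> real^'n"
    and g :: "nat \<Rightarrow> real^'n \<Rightarrow> real^'n"
    and x xs l :: "nat \<Rightarrow> real^'n"
    and G M R \<epsilon> \<alpha> \<mu> :: real
    and T :: nat
  assumes "convex X"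
    and "\<And>t. convex_on UNIV (f t)"
    and "\<And>t y. GDERIV (f t) y :> df t y"
    and "\<And>t i. convex_on UNIV (\<lambda>y. g t y $ i)"
    and "\<And>t y. y \<in> X \<Longrightarrow> norm (df t y) \<le> G"
    and "\<And>t y. y \<in> X \<Longrightarrow> norm (g t y) \<le> M"
    and "\<And>y z. y \<in> X \<Longrightarrow> z \<in> X \<Longrightarrow> norm (y - z) \<le> R"
    and "\<epsilon> > 0"
    and "\<exists>y \<in> interior X. \<forall>t. g t y \<le> - (\<epsilon> *\<^sub>R 1)"
    and "\<And>t. t \<ge> 1 \<Longrightarrow> \<exists>y. is_arg_max (constr_increase g t) (\<lambda>y. y \<in> X) y"
    and "\<epsilon> > constr_var_sup X g"
    and "\<And>t. slot_minimizer X f g t (xs t)"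
    and "\<alpha> > 0" and "\<mu> > 0"
    and "mosp X df g \<alpha> \<mu> x l"
    and "l 1 = 0"
    and "T \<ge> 1"
  shows "dyn_regret f x xs T
    \<le> R * path_var xs T / \<alpha>
      + dual_bound G M R \<epsilon> \<alpha> \<mu> (constr_var_sup X g) * total_constr_var X g T
      + R\<^sup>2 / (2 * \<alpha>) + \<alpha> * G\<^sup>2 * real T / 2 + \<mu> * M\<^sup>2 * (real T + 1) / 2"
proof -
  obtain y where y: "y \<in> X" "\<And>t. g t y \<le> - (\<epsilon> *\<^sub>R 1)"
    using assms(9) interior_subset by blast
  have xin: "x t \<in> X" for t
    using assms(15) by (rule mosp_primal_in)
  have xs: "xs t \<in> X" "g t (xs t) \<le> 0" for t
    using assms(12)[of t] by (auto simp: slot_minimizer_def is_arg_min_def)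
  define \<Lambda> where "\<Lambda> = dual_bound G M R \<epsilon> \<alpha> \<mu> (constr_var_sup X g)"
  define K where "K = \<alpha> * G\<^sup>2 / 2 + \<mu> * M\<^sup>2 / 2"
  define D where "D t = (norm (xs t - x t))\<^sup>2 - (norm (xs t - x (Suc t)))\<^sup>2" for t
  \<comment> \<open>The index is shifted because slot \<open>t\<close> involves the drift from
    \<open>l (Suc t)\<close> to \<open>l (Suc (Suc t))\<close>.\<close>
  define E where "E t = (norm (l (Suc t)))\<^sup>2 / (2 * \<mu>)" for t
  have nonneg: "0 \<le> constr_var X g t" for t
    using order_trans[OF _ constr_increase_le_var[OF assms(6) y(1)]] by (simp add: constr_increase_def)
  have slot: "f t (x t) - f t (xs t) \<le> D t / (2 * \<alpha>) + K + \<Lambda> * constr_var X g t - (E (Suc t) - E t)" for t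
  proof -
    have "norm (l (Suc t)) \<le> \<Lambda>"
      unfolding \<Lambda>_def using assms y by (intro mosp_dual_bound[of X df g \<alpha> \<mu> x l G M R y \<epsilon> t]) auto
    then have "norm (l (Suc t)) * constr_var X g t \<le> \<Lambda> * constr_var X g t"
      using nonneg by (rule mult_right_mono)
    with mosp_slot_regret[of X df g \<alpha> \<mu> x l f t G M "xs t"] assms xs show ?thesis
      unfolding D_def E_def K_def by (simp add: diff_divide_distrib)
  qed
  have "dyn_regret f x xs T = (\<Sum>t=1..T. f t (x t) - f t (xs t))"
    by (simp add: dyn_regret_def sum_subtractf)
  also have "\<dots> \<le> (\<Sum>t=1..T. D t / (2 * \<alpha>) + K + \<Lambda> * constr_var X g t - (E (Suc t) - E t))"
    by (intro sum_mono slot)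
  also have "\<dots> = (\<Sum>t=1..T. D t) / (2 * \<alpha>) + K * real T + \<Lambda> * total_constr_var X g T
      - (\<Sum>t=1..T. E (Suc t) - E t)"
    by (simp add: sum.distrib sum_subtractf sum_divide_distrib sum_distrib_left total_constr_var_def)
  also have "(\<Sum>t=1..T. E (Suc t) - E t) = E (Suc T) - E 1"
    using sum_Suc_diff[of 1 T E] assms(17) by simp
  also have "(\<Sum>t=1..T. D t) / (2 * \<alpha>) \<le> (2 * R * path_var xs T + R\<^sup>2) / (2 * \<alpha>)"
    unfolding D_def using assms(7,13) xs(1) xin by (intro divide_right_mono sum_dist_telescope_le) auto
  also have "(2 * R * path_var xs T + R\<^sup>2) / (2 * \<alpha>) = R * path_var xs T / \<alpha> + R\<^sup>2 / (2 * \<alpha>)"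
    using assms(13) by (simp add: field_simps)
  finally have "dyn_regret f x xs T \<le> R * path_var xs T / \<alpha> + R\<^sup>2 / (2 * \<alpha>) + K * real T
      + \<Lambda> * total_constr_var X g T - (E (Suc T) - E 1)"
    by simp
  \<comment> \<open>The telescoped drift starts at \<open>l 2\<close> rather than at
    \<open>l 1 = 0\<close>. One dual step from zero bounds this initial term, which accounts for
    \<open>T + 1\<close> instead of \<open>T\<close> in the last summand.\<close>
  moreover have "E 1 \<le> \<mu> * M\<^sup>2 / 2"
    using norm_pos_part_step(2)[of "g 1 (x 1)" M \<mu> "l 1"] assms(6,14,16) xin
      mosp_dual_step[OF assms(15), of 1] by (simp add: E_def)
  moreover have "0 \<le> E (Suc T)"
    using assms(14) by (simp add: E_def)
  moreover have "K * real T + \<mu> * M\<^sup>2 / 2 = \<alpha> * G\<^sup>2 * real T / 2 + \<mu> * M\<^sup>2 * (real T + 1) / 2"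
    by (simp add: K_def field_simps)
  ultimately show ?thesis unfolding \<Lambda>_def by linarith
qed

end
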